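(* Let $\mu$ be a finite measure on a measurable space $(\Omega,\Sigma)$, let $K$ be a compact Hausdorff space, and let $L_1(\mu)$ and $C(K)$ be the real Banach spaces. Let $0<\varepsilon<1$. Suppose that $T\in\mathcal{L}(L_1(\mu),C(K))$ has norm one and that there exists a co-meager set $G\subset K$ such that $\{T^*\delta_s : s\in G\}$ is norm separable in $L_\infty(\mu)$. If $\|Tf\|>1-\frac{\varepsilon^2}{4}$ for some $f\in L_1(\mu)$ with $\|f\|=1$, then there exist $S\in\mathcal{L}(L_1(\mu),C(K))$ with $\|S\|=1$ and $g\in L_1(\mu)$ with $\|g\|=1$ such that $\|Sg\|=1$, $\|S-T\|<\varepsilon$ and $\|f-g\|<\varepsilon$. Moreover, $S$ can be taken such that there also exists a co-meager set $G'\subset K$ for which $\{S^*\delta_s : s\in G'\}$ is norm separable in $L_\infty(\mu)$.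
   Context: $\mathcal{L}(X,Y)$ is the space of bounded linear operators from $X$ to $Y$ with the operator norm. For $s\in K$, $\delta_s\in C(K)^*$ is the point measure (evaluation) at $s$, and $T^*\delta_s\in L_1(\mu)^*=L_\infty(\mu)$, so that $Tf(s)=\int_\Omega f\cdot T^*\delta_s\,d\mu$. A subset $A$ of $K$ is co-meager if $K\setminus A$ is meager, that is, of first category in $K$. *)

theory Defs
  imports "HOL-Analysis.Analysis" "HOL-Probability.Essential_Supremum"
begin

text \<open>
  Elements of \<open>L\<^sub>1(\<mu>)\<close> and \<open>L\<^sub>\<infinity>(\<mu>)\<close> are given by representatives. For a compact Hausdorff space
  \<open>K\<close>, the Banach space \<open>C(K)\<close> is the library type of bounded continuous functions
  \<open>'k \<Rightarrow>\<^sub>C real\<close> with the supremum norm, where \<open>K\<close> is the universe of the type \<open>'k\<close>.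
\<close>

definition L1_norm :: "'a measure \<Rightarrow> ('a \<Rightarrow> real) \<Rightarrow> real" where
  "L1_norm M f = (\<integral>x. \<bar>f x\<bar> \<partial>M)"

definition Linf_norm :: "'a measure \<Rightarrow> ('a \<Rightarrow> real) \<Rightarrow> ereal" where
  "Linf_norm M h = esssup M (\<lambda>x. ereal \<bar>h x\<bar>)"

definition Linf :: "'a measure \<Rightarrow> ('a \<Rightarrow> real) set" where
  "Linf M = {h \<in> borel_measurable M. Linf_norm M h < \<infinity>}"

text \<open>
  Linearity together with the bound forces \<open>T f = T g\<close> whenever \<open>f\<close> and \<open>g\<close> are integrable and agree
  almost everywhere, so such a \<open>T\<close> is the same thing as an operator on equivalence classes
  (see \<open>L1_operator_cong_AE\<close>). Values of \<open>T\<close> at non-integrable functions are irrelevant.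
\<close>

definition L1_operator :: "'a measure \<Rightarrow> (('a \<Rightarrow> real) \<Rightarrow> 'b::real_normed_vector) \<Rightarrow> bool" where
  "L1_operator M T \<longleftrightarrow>
     (\<forall>f g. integrable M f \<longrightarrow> integrable M g \<longrightarrow> T (\<lambda>x. f x + g x) = T f + T g) \<and>
     (\<forall>c f. integrable M f \<longrightarrow> T (\<lambda>x. c * f x) = c *\<^sub>R T f) \<and>
     (\<exists>C. \<forall>f. integrable M f \<longrightarrow> norm (T f) \<le> C * L1_norm M f)"

definition L1_opnorm :: "'a measure \<Rightarrow> (('a \<Rightarrow> real) \<Rightarrow> 'b::real_normed_vector) \<Rightarrow> real" where
  "L1_opnorm M T = (SUP f \<in> {f. integrable M f \<and> L1_norm M f \<le> 1}. norm (T f))"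

text \<open>
  A representative of \<open>T\<^sup>* \<delta>\<^sub>s\<close> under the identification of \<open>L\<^sub>1(\<mu>)\<^sup>*\<close> with \<open>L\<^sub>\<infinity>(\<mu>)\<close>. For finite
  \<open>\<mu>\<close> and bounded \<open>T\<close> it exists (see \<open>adjoint_delta\<close>) and is unique almost everywhere.
\<close>

definition adjoint_delta ::
  "'a measure \<Rightarrow> (('a \<Rightarrow> real) \<Rightarrow> ('k::topological_space \<Rightarrow>\<^sub>C real)) \<Rightarrow> 'k \<Rightarrow> 'a \<Rightarrow> real" where
  "adjoint_delta M T s =
     (SOME h. h \<in> Linf M \<and>
        (\<forall>f. integrable M f \<longrightarrow> apply_bcontfun (T f) s = (\<integral>x. f x * h x \<partial>M)))"

definition Linf_separable :: "'a measure \<Rightarrow> ('a \<Rightarrow> real) set \<Rightarrow> bool" where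
  "Linf_separable M A \<longleftrightarrow>
     (\<exists>D. countable D \<and> D \<subseteq> A \<and>
        (\<forall>h\<in>A. \<forall>e>0. \<exists>d\<in>D. Linf_norm M (\<lambda>x. h x - d x) < ereal e))"

definition nowhere_dense :: "'k::topological_space set \<Rightarrow> bool" where
  "nowhere_dense A \<longleftrightarrow> interior (closure A) = {}"

definition meager :: "'k::topological_space set \<Rightarrow> bool" where
  "meager A \<longleftrightarrow> (\<exists>F :: nat \<Rightarrow> 'k set. (\<forall>n. nowhere_dense (F n)) \<and> A = (\<Union>n. F n))"

definition comeager :: "'k::topological_space set \<Rightarrow> bool" where
  "comeager G \<longleftrightarrow> meager (- G)"


lemma L1_operator_bound:
  assumes "L1_operator M T"
  obtains C where "C \<ge> 0" "\<And>f. integrable M f \<Longrightarrow> norm (T f) \<le> C * L1_norm M f"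
proof -
  obtain C where C: "\<And>f. integrable M f \<Longrightarrow> norm (T f) \<le> C * L1_norm M f"
    using assms unfolding L1_operator_def by blast
  have "norm (T f) \<le> max C 0 * L1_norm M f" if "integrable M f" for f
  proof -
    have "C * L1_norm M f \<le> max C 0 * L1_norm M f"
      by (intro mult_right_mono) (auto simp: L1_norm_def)
    with C[OF that] show ?thesis by linarith
  qed
  then show ?thesis by (intro that[of "max C 0"]) auto
qed

lemma L1_operator_diff:
  assumes T: "L1_operator M T" and f: "integrable M f" and g: "integrable M g"
  shows "T (\<lambda>x. f x - g x) = T f - T g"
proof -
  have "T (\<lambda>x. - 1 * g x) = - 1 *\<^sub>R T g"
    using T g unfolding L1_operator_def by blast
  moreover have "T (\<lambda>x. f x + - 1 * g x) = T f + T (\<lambda>x. - 1 * g x)"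
    using T f integrable_mult_right[OF g, of "- 1"] unfolding L1_operator_def by blast
  ultimately show ?thesis by simp
qed

lemma L1_operator_cong_AE:
  assumes T: "L1_operator M T" and f: "integrable M f" and g: "integrable M g"
    and ae: "AE x in M. f x = g x"
  shows "T f = T g"
proof -
  obtain C where C: "\<And>f. integrable M f \<Longrightarrow> norm (T f) \<le> C * L1_norm M f"
    using L1_operator_bound[OF T] by blast
  have "L1_norm M (\<lambda>x. f x - g x) = (\<integral>x. 0 \<partial>M)"
    unfolding L1_norm_def by (rule integral_cong_AE) (use f g ae in auto)
  with C[of "\<lambda>x. f x - g x"] f g have "norm (T (\<lambda>x. f x - g x)) \<le> 0" by simp
  then show ?thesis using L1_operator_diff[OF T f g] by simp
qed

lemma L1_functional_representation:
  fixes T :: "('a \<Rightarrow> real) \<Rightarrow> real"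
  assumes "finite_measure M" and T: "L1_operator M T"
  shows "\<exists>h \<in> Linf M. \<forall>f. integrable M f \<longrightarrow> T f = (\<integral>x. f x * h x \<partial>M)"
proof -
  interpret finite_measure M by fact
  obtain C where C0: "C \<ge> 0" and C: "\<And>f. integrable M f \<Longrightarrow> \<bar>T f\<bar> \<le> C * L1_norm M f"
    using L1_operator_bound[OF T] by auto
  have add: "T (\<lambda>x. f x + g x) = T f + T g" if "integrable M f" "integrable M g" for f g
    using T that unfolding L1_operator_def by blast
  have scale: "T (\<lambda>x. c * f x) = c * T f" if "integrable M f" for c f
    using T that unfolding L1_operator_def by simp
  note diff = L1_operator_diff[OF T]
  have int_ind[simp]: "integrable M (indicat_real A)" if "A \<in> sets M" for A
    using that by (simp add: emeasure_finite less_top[symmetric])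
  have norm_ind: "L1_norm M (indicat_real A) = measure M A" if "A \<in> sets M" for A
    using that sets.sets_into_space[OF that] by (simp add: L1_norm_def Int_absorb2)
  have bnd: "\<bar>T (indicat_real A)\<bar> \<le> C * measure M A" if "A \<in> sets M" for A
    using C[of "indicat_real A"] norm_ind[OF that] that by simp
  define n where "n A = T (indicat_real A) + C * measure M A" for A
  have n_bnd: "0 \<le> n A" "n A \<le> 2 * C * measure M A" if "A \<in> sets M" for A
    using bnd[OF that] unfolding n_def by auto
  have T0: "T (indicat_real {}) = 0" using bnd[of "{}"] by simp
  have n_Un: "n (A \<union> B) = n A + n B" if "A \<in> sets M" "B \<in> sets M" "A \<inter> B = {}" for A B
  proof -
    have "indicat_real (A \<union> B) = (\<lambda>x. indicat_real A x + indicat_real B x)"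
      using that(3) by (intro ext) (auto simp: indicator_def)
    then show ?thesis using that add[of "indicat_real A" "indicat_real B"]
      by (simp add: n_def finite_measure_Union algebra_simps)
  qed
  define N where "N = measure_of (space M) (sets M) (\<lambda>A. ennreal (n A))"
  have [simp]: "sets N = sets M" "space N = space M"
    by (auto simp: N_def sets.space_closed)
  have pos: "positive (sets M) (\<lambda>A. ennreal (n A))"
    unfolding positive_def by (simp add: n_def T0)
  have ca: "countably_additive (sets M) (\<lambda>A. ennreal (n A))"
  proof (rule countably_additiveI)
    fix A :: "nat \<Rightarrow> 'a set"
    assume A: "range A \<subseteq> sets M" "disjoint_family A" "(\<Union>i. A i) \<in> sets M"
    have Ai[measurable]: "A i \<in> sets M" for i using A(1) by auto
    have part: "(\<Sum>i<k. n (A i)) = n (\<Union>i<k. A i)" for k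
    proof (induction k)
      case 0 then show ?case by (simp add: n_def T0)
    next
      case (Suc k)
      have "A i \<inter> A k = {}" if "i < k" for i
        using disjoint_family_onD[OF A(2), of i k] that by simp
      then have "(\<Union>i<k. A i) \<inter> A k = {}" by blast
      then have "n ((\<Union>i<k. A i) \<union> A k) = n (\<Union>i<k. A i) + n (A k)"
        by (intro n_Un) auto
      with Suc show ?case by (simp add: lessThan_Suc Un_commute)
    qed
    have rest: "n (\<Union>i. A i) - n (\<Union>i<k. A i) = n ((\<Union>i. A i) - (\<Union>i<k. A i))" for k
    proof -
      have "n ((\<Union>i<k. A i) \<union> ((\<Union>i. A i) - (\<Union>i<k. A i)))
          = n (\<Union>i<k. A i) + n ((\<Union>i. A i) - (\<Union>i<k. A i))"
        by (intro n_Un) auto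
      moreover have "(\<Union>i<k. A i) \<union> ((\<Union>i. A i) - (\<Union>i<k. A i)) = (\<Union>i. A i)" by auto
      ultimately show ?thesis by simp
    qed
    have "(\<lambda>k. measure M (\<Union>i<k. A i)) \<longlonglongrightarrow> measure M (\<Union>k. \<Union>i<k. A i)"
      by (intro finite_Lim_measure_incseq) (auto simp: incseq_def intro: less_le_trans)
    moreover have "(\<Union>k. \<Union>i<k. A i) = (\<Union>i. A i)" by auto
    ultimately have "(\<lambda>k. measure M (\<Union>i<k. A i)) \<longlonglongrightarrow> measure M (\<Union>i. A i)" by simp
    then have lim: "(\<lambda>k. 2 * C * (measure M (\<Union>i. A i) - measure M (\<Union>i<k. A i))) \<longlonglongrightarrow> 0"
      by (auto intro!: tendsto_eq_intros)
    have "(\<lambda>k. n (\<Union>i. A i) - n (\<Union>i<k. A i)) \<longlonglongrightarrow> 0"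
    proof (rule tendsto_sandwich[OF _ _ tendsto_const lim])
      show "\<forall>\<^sub>F k in sequentially. 0 \<le> n (\<Union>i. A i) - n (\<Union>i<k. A i)"
        unfolding rest by (intro always_eventually allI n_bnd) auto
      show "\<forall>\<^sub>F k in sequentially. n (\<Union>i. A i) - n (\<Union>i<k. A i)
          \<le> 2 * C * (measure M (\<Union>i. A i) - measure M (\<Union>i<k. A i))"
      proof (intro always_eventually allI)
        fix k
        have "measure M ((\<Union>i. A i) - (\<Union>i<k. A i)) = measure M (\<Union>i. A i) - measure M (\<Union>i<k. A i)"
          by (intro finite_measure_Diff) auto
        then show "n (\<Union>i. A i) - n (\<Union>i<k. A i)
            \<le> 2 * C * (measure M (\<Union>i. A i) - measure M (\<Union>i<k. A i))"
          unfolding rest using n_bnd(2)[of "(\<Union>i. A i) - (\<Union>i<k. A i)"] by simp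
      qed
    qed
    then have "(\<lambda>k. n (\<Union>i. A i) - (n (\<Union>i. A i) - n (\<Union>i<k. A i))) \<longlonglongrightarrow> n (\<Union>i. A i) - 0"
      by (intro tendsto_diff tendsto_const)
    then have "(\<lambda>i. n (A i)) sums n (\<Union>i. A i)"
      unfolding sums_def part by simp
    then show "(\<Sum>i. ennreal (n (A i))) = ennreal (n (\<Union>i. A i))"
      by (intro sums_unique[symmetric]) (simp add: n_bnd)
  qed
  have em: "emeasure N A = ennreal (n A)" if "A \<in> sets M" for A
    unfolding N_def by (rule emeasure_measure_of_sigma) (use pos ca that in \<open>auto intro: sets.sigma_algebra_axioms\<close>)
  have "absolutely_continuous M N"
    unfolding absolutely_continuous_def
  proof
    fix A assume "A \<in> null_sets M"
    then have A: "A \<in> sets M" "measure M A = 0" by (auto simp: measure_eq_0_null_sets)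
    then show "A \<in> null_sets N" using n_bnd[OF A(1)] em[OF A(1)] by (auto simp: null_sets_def)
  qed
  then obtain d where d[measurable]: "d \<in> borel_measurable M" and dN: "density M d = N"
    using Radon_Nikodym[of N] by auto
  define B where "B = {x \<in> space M. d x > ennreal (2 * C)}"
  have B[measurable]: "B \<in> sets M" unfolding B_def by measurable
  have "(\<integral>\<^sup>+x. (d x - ennreal (2*C)) * indicator B x \<partial>M) + ennreal (2*C) * emeasure M B
      = (\<integral>\<^sup>+x. (d x - ennreal (2*C)) * indicator B x + ennreal (2*C) * indicator B x \<partial>M)"
    by (subst nn_integral_add) (auto simp: nn_integral_cmult_indicator)
  also have "\<dots> = (\<integral>\<^sup>+x. d x * indicator B x \<partial>M)"
    by (intro nn_integral_cong) (auto simp: B_def indicator_def intro!: diff_add_cancel_ennreal)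
  also have "\<dots> = emeasure N B"
    unfolding dN[symmetric] by (simp add: emeasure_density)
  also have "\<dots> \<le> ennreal (2*C) * emeasure M B"
    using n_bnd[OF B] em[OF B] C0 by (simp add: emeasure_eq_measure ennreal_mult[symmetric] ennreal_leI)
  finally have "(\<integral>\<^sup>+x. (d x - ennreal (2*C)) * indicator B x \<partial>M) = 0"
    by (cases "(\<integral>\<^sup>+x. (d x - ennreal (2*C)) * indicator B x \<partial>M)")
       (use C0 in \<open>auto simp: emeasure_eq_measure ennreal_mult[symmetric] ennreal_plus[symmetric] top_unique simp del: ennreal_plus\<close>)
  then have "AE x in M. (d x - ennreal (2*C)) * indicator B x = 0"
    by (subst (asm) nn_integral_0_iff_AE) auto
  with AE_space have dbnd: "AE x in M. d x \<le> ennreal (2*C)"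
  proof (eventually_elim)
    case (elim x)
    then show ?case
      by (cases "d x \<le> ennreal (2*C)") (auto simp: B_def indicator_def diff_eq_0_iff_ennreal split: if_splits)
  qed
  define h where "h x = enn2real (d x) - C" for x
  have h[measurable]: "h \<in> borel_measurable M" unfolding h_def by measurable
  have e_bnd: "AE x in M. ennreal (enn2real (d x)) = d x \<and> enn2real (d x) \<le> 2 * C"
    using dbnd
  proof eventually_elim
    case (elim x)
    then have "d x < top" using ennreal_less_top order_le_less_trans by blast
    with elim show ?case
      using enn2real_mono[OF elim] C0 by simp
  qed
  have h_bnd: "AE x in M. \<bar>h x\<bar> \<le> C"
    using e_bnd by eventually_elim (auto simp: h_def abs_le_iff)
  have "Linf_norm M h \<le> ereal C"
    unfolding Linf_norm_def by (intro esssup_I) (use h_bnd in auto)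
  then have hL: "h \<in> Linf M"
    unfolding Linf_def using h by (auto intro: order_le_less_trans)
  have int_h: "integrable M (\<lambda>x. f x * h x)" if "integrable M f" for f :: "'a \<Rightarrow> real"
  proof (rule Bochner_Integration.integrable_bound)
    show "integrable M (\<lambda>x. C * f x)" using that by simp
    show "AE x in M. norm (f x * h x) \<le> norm (C * f x)"
      using h_bnd by eventually_elim (use C0 in \<open>simp add: abs_mult mult.commute[of C] mult_left_mono\<close>)
  qed (use that in measurable)
  have "T f = (\<integral>x. f x * h x \<partial>M)" if "integrable M f" for f
    using that
  proof (induction rule: integrable_induct)
    case (base A c)
    have A[measurable]: "A \<in> sets M" using base by simp
    have int_e: "integrable M (\<lambda>x. indicat_real A x * enn2real (d x))"
    proof (rule Bochner_Integration.integrable_bound)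
      show "integrable M (\<lambda>x. indicat_real A x * h x + C * indicat_real A x)"
        using int_h[OF int_ind[OF A]] A by simp
    qed (auto simp: h_def algebra_simps)
    have "ennreal (n A) = (\<integral>\<^sup>+x. d x * indicator A x \<partial>M)"
      unfolding em[OF A, symmetric] dN[symmetric] by (simp add: emeasure_density)
    also have "\<dots> = (\<integral>\<^sup>+x. ennreal (indicat_real A x * enn2real (d x)) \<partial>M)"
      by (intro nn_integral_cong_AE, use e_bnd in eventually_elim) (auto simp: indicator_def)
    also have "\<dots> = ennreal (\<integral>x. indicat_real A x * enn2real (d x) \<partial>M)"
      by (intro nn_integral_eq_integral int_e) auto
    finally have nA: "n A = (\<integral>x. indicat_real A x * enn2real (d x) \<partial>M)"
      using n_bnd(1)[OF A] by (subst (asm) ennreal_inj) (auto intro!: integral_nonneg_AE)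
    have "(\<integral>x. indicat_real A x * h x \<partial>M)
        = (\<integral>x. indicat_real A x * enn2real (d x) - C * indicat_real A x \<partial>M)"
      by (simp add: h_def algebra_simps)
    also have "\<dots> = n A - C * measure M A"
      unfolding nA using int_e A sets.sets_into_space[OF A]
      by (subst Bochner_Integration.integral_diff) (auto simp: Int_absorb2)
    finally have TA: "T (indicat_real A) = (\<integral>x. indicat_real A x * h x \<partial>M)"
      by (simp add: n_def)
    show ?case
      using scale[OF int_ind[OF A], of c] TA by (simp add: mult.commute mult.left_commute)
  next
    case (add f g)
    then show ?case
      using \<open>\<And>f g. integrable M f \<Longrightarrow> integrable M g \<Longrightarrow> T (\<lambda>x. f x + g x) = T f + T g\<close>[of f g] int_h
      by (simp add: distrib_right)
  next
    case (lim f s)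
    have sf: "AE x in M. (\<lambda>i. s i x) \<longlonglongrightarrow> f x"
      using lim(2) by (intro AE_I2)
    have sb: "AE x in M. norm (s i x) \<le> 2 * norm (f x)" for i
      using lim(3) by (intro AE_I2)
    have ints: "integrable M (s i)" for i by (rule lim)
    have [measurable]: "f \<in> borel_measurable M" "s i \<in> borel_measurable M" for i
      using lim(4) ints by auto
    have d0: "(\<lambda>i. L1_norm M (\<lambda>x. s i x - f x)) \<longlonglongrightarrow> (\<integral>x. 0 \<partial>M)"
      unfolding L1_norm_def
    proof (rule integral_dominated_convergence)
      show "integrable M (\<lambda>x. 3 * \<bar>f x\<bar>)" using lim(4) by simp
      show "AE x in M. (\<lambda>i. \<bar>s i x - f x\<bar>) \<longlonglongrightarrow> 0"
        using sf
      proof eventually_elim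
        case (elim x)
        then have "(\<lambda>i. \<bar>s i x - f x\<bar>) \<longlonglongrightarrow> \<bar>f x - f x\<bar>" by (intro tendsto_intros)
        then show ?case by simp
      qed
      show "AE x in M. norm \<bar>s i x - f x\<bar> \<le> 3 * \<bar>f x\<bar>" for i
        using sb[of i] by eventually_elim auto
    qed auto
    have cd0: "(\<lambda>i. C * L1_norm M (\<lambda>x. s i x - f x)) \<longlonglongrightarrow> 0"
      using tendsto_mult_left[OF d0, of C] by simp
    have conv: "(\<lambda>i. F (s i)) \<longlonglongrightarrow> F f"
      if "\<And>i. \<bar>F (s i) - F f\<bar> \<le> C * L1_norm M (\<lambda>x. s i x - f x)" for F :: "('a \<Rightarrow> real) \<Rightarrow> real"
      using that by (intro LIM_zero_cancel[OF Lim_null_comparison[OF _ cd0]]) auto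
    have "(\<lambda>i. T (s i)) \<longlonglongrightarrow> T f"
    proof (rule conv)
      show "\<bar>T (s i) - T f\<bar> \<le> C * L1_norm M (\<lambda>x. s i x - f x)" for i
        using C[OF Bochner_Integration.integrable_diff[OF ints[of i] lim(4)]] diff[OF ints[of i] lim(4)]
        by simp
    qed
    moreover have "(\<lambda>i. \<integral>x. s i x * h x \<partial>M) \<longlonglongrightarrow> (\<integral>x. f x * h x \<partial>M)"
    proof (rule conv)
      fix i
      have D: "integrable M (\<lambda>x. s i x - f x)" using ints lim(4) by simp
      have "(\<integral>x. s i x * h x \<partial>M) - (\<integral>x. f x * h x \<partial>M) = (\<integral>x. (s i x - f x) * h x \<partial>M)"
        using int_h ints lim(4) by (simp add: left_diff_distrib)
      also have "\<bar>\<dots>\<bar> \<le> (\<integral>x. C * \<bar>s i x - f x\<bar> \<partial>M)"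
      proof (rule order_trans[OF integral_abs_bound integral_mono_AE])
        show "AE x in M. \<bar>(s i x - f x) * h x\<bar> \<le> C * \<bar>s i x - f x\<bar>"
          using h_bnd by eventually_elim (simp add: abs_mult mult.commute[of C] mult_left_mono)
      qed (use D int_h[OF D] in auto)
      finally show "\<bar>(\<integral>x. s i x * h x \<partial>M) - (\<integral>x. f x * h x \<partial>M)\<bar> \<le> C * L1_norm M (\<lambda>x. s i x - f x)"
        by (simp add: L1_norm_def)
    qed
    ultimately show ?case unfolding lim.IH by (rule LIMSEQ_unique)
  qed
  with hL show ?thesis by blast
qed

lemma adjoint_delta:
  fixes T :: "('a \<Rightarrow> real) \<Rightarrow> ('k::topological_space \<Rightarrow>\<^sub>C real)"
  assumes "finite_measure M" and T: "L1_operator M T"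
  shows "adjoint_delta M T s \<in> Linf M"
    and "\<forall>f. integrable M f \<longrightarrow> apply_bcontfun (T f) s = (\<integral>x. f x * adjoint_delta M T s x \<partial>M)"
proof -
  obtain C where C: "\<And>f. integrable M f \<Longrightarrow> norm (T f) \<le> C * L1_norm M f"
    using L1_operator_bound[OF T] by blast
  have "L1_operator M (\<lambda>f. apply_bcontfun (T f) s)"
    unfolding L1_operator_def
  proof (intro conjI exI allI impI)
    fix f :: "'a \<Rightarrow> real" assume "integrable M f"
    with C show "norm (apply_bcontfun (T f) s) \<le> C * L1_norm M f"
      using norm_bounded[of "T f" s] by (meson order_trans)
  qed (use T in \<open>auto simp: L1_operator_def\<close>)
  from L1_functional_representation[OF assms(1) this]
  have "\<exists>h. h \<in> Linf M \<and> (\<forall>f. integrable M f \<longrightarrow> apply_bcontfun (T f) s = (\<integral>x. f x * h x \<partial>M))"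
    by blast
  from someI_ex[OF this]
  show "adjoint_delta M T s \<in> Linf M"
    and "\<forall>f. integrable M f \<longrightarrow> apply_bcontfun (T f) s = (\<integral>x. f x * adjoint_delta M T s x \<partial>M)"
    unfolding adjoint_delta_def by blast+
qed

end

theory Submission
  imports Defs
begin

text \<open>
  Write \<open>h\<^sub>s = T\<^sup>* \<delta>\<^sub>s\<close>. Norm balls of \<open>L\<^sub>\<infinity>(\<mu>)\<close> are weak-star closed, so \<open>{s. \<parallel>h\<^sub>s - d\<parallel> \<le> \<epsilon>/8}\<close> is
  closed in \<open>K\<close>. Countably many of these sets cover the co-meager set \<open>G\<close>, so by Baire's theorem the
  nonempty open set on which \<open>\<sigma> Tf > 1 - \<epsilon>\<^sup>2/4\<close> (with a sign \<open>\<sigma>\<close>) meets the interior \<open>V\<close> of one of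
  them, in a point \<open>s\<^sub>1\<close>, say. Put \<open>p = \<sigma> sgn f\<close> and \<open>A = {h\<^bsub>s\<^sub>1\<^esub> p > 1 - \<epsilon>/2}\<close>. As \<open>f\<close> almost norms
  \<open>h\<^bsub>s\<^sub>1\<^esub>\<close>, its mass outside \<open>A\<close> is less than \<open>\<epsilon>/2\<close>, so the normalized restriction \<open>g\<close> of \<open>f\<close> to \<open>A\<close>
  is within \<open>\<epsilon>\<close> of \<open>f\<close>. With a Urysohn function \<open>\<phi>\<close> supported in \<open>V\<close> and \<open>\<phi>(s\<^sub>1) = 1\<close>, let \<open>S\<close> be
  the operator with \<open>S\<^sup>* \<delta>\<^sub>s = h\<^sub>s + \<phi>(s) 1\<^sub>A (p - h\<^sub>s)\<close>. Pointwise this is a convex combination, so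
  \<open>\<parallel>S\<parallel> \<le> 1\<close>; moreover \<open>Sg(s\<^sub>1) = \<sigma>\<close>, and \<open>\<bar>p - h\<^sub>s\<bar> \<le> \<epsilon>/2 + \<epsilon>/8 + \<epsilon>/8\<close> on \<open>A\<close> for \<open>s \<in> V\<close>.
\<close>

section \<open>Essential bounds and the pairing of integrable with essentially bounded
  functions\<close>

lemma Linf_AE_boundE:
  assumes "h \<in> Linf M"
  obtains C where "C \<ge> 0" "AE x in M. \<bar>h x\<bar> \<le> C"
proof -
  have "Linf_norm M h < \<infinity>" using assms by (simp add: Linf_def)
  then obtain C where C: "Linf_norm M h \<le> ereal C"
    by (cases "Linf_norm M h") auto
  have "AE x in M. ereal \<bar>h x\<bar> \<le> Linf_norm M h"
    unfolding Linf_norm_def by (rule esssup_AE)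
  \<comment> \<open>Over a null measure the essential supremum is -\<infinity>, so the real
    \<open>C\<close> may be negative; the maximum with 0 repairs this.\<close>
  then have "AE x in M. \<bar>h x\<bar> \<le> max C 0"
  proof eventually_elim
    case (elim x)
    then have "ereal \<bar>h x\<bar> \<le> ereal C" using C by (rule order_trans)
    then show ?case by simp
  qed
  then show ?thesis by (intro that[of "max C 0"]) auto
qed

lemma Linf_norm_le:
  assumes "h \<in> borel_measurable M" "AE x in M. \<bar>h x\<bar> \<le> r"
  shows "Linf_norm M h \<le> ereal r"
  unfolding Linf_norm_def by (intro esssup_I) (use assms in auto)

lemma Linf_norm_less_AE:
  assumes "Linf_norm M h < ereal r"
  shows "AE x in M. \<bar>h x\<bar> \<le> r"
proof -
  have "AE x in M. ereal \<bar>h x\<bar> \<le> Linf_norm M h"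
    unfolding Linf_norm_def by (rule esssup_AE)
  then show ?thesis
  proof eventually_elim
    case (elim x)
    then have "ereal \<bar>h x\<bar> < ereal r" using assms by (rule order_le_less_trans)
    then show ?case by simp
  qed
qed

lemma LinfI:
  assumes "h \<in> borel_measurable M" "AE x in M. \<bar>h x\<bar> \<le> r"
  shows "h \<in> Linf M"
  using Linf_norm_le[OF assms] assms(1) by (auto simp: Linf_def intro: order_le_less_trans)

lemma integrable_mult_AE_bounded:
  fixes u k :: "'a \<Rightarrow> real"
  assumes u: "integrable M u" and k: "k \<in> borel_measurable M" and r: "AE x in M. \<bar>k x\<bar> \<le> r"
  shows "integrable M (\<lambda>x. u x * k x)"
proof (rule Bochner_Integration.integrable_bound)
  show "integrable M (\<lambda>x. r * u x)" using u by simp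
  show "AE x in M. norm (u x * k x) \<le> norm (r * u x)"
    using r by eventually_elim (auto simp: abs_mult mult.commute intro!: mult_right_mono)
qed (use u k in measurable)

lemma integral_mult_AE_bounded:
  fixes u k :: "'a \<Rightarrow> real"
  assumes u: "integrable M u" and k: "k \<in> borel_measurable M" and r: "AE x in M. \<bar>k x\<bar> \<le> r"
  shows "\<bar>\<integral>x. u x * k x \<partial>M\<bar> \<le> r * L1_norm M u"
proof -
  have "\<bar>\<integral>x. u x * k x \<partial>M\<bar> \<le> (\<integral>x. r * \<bar>u x\<bar> \<partial>M)"
  proof (rule order_trans[OF integral_abs_bound integral_mono_AE])
    show "AE x in M. \<bar>u x * k x\<bar> \<le> r * \<bar>u x\<bar>"
      using r by eventually_elim (auto simp: abs_mult mult.commute[of r] intro!: mult_left_mono)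
  qed (use u integrable_mult_AE_bounded[OF assms] in auto)
  then show ?thesis by (simp add: L1_norm_def)
qed

lemma integrable_mult_Linf:
  assumes "integrable M u" "h \<in> Linf M"
  shows "integrable M (\<lambda>x. u x * h x)"
proof -
  obtain C where "AE x in M. \<bar>h x\<bar> \<le> C" using Linf_AE_boundE[OF assms(2)] by blast
  then show ?thesis using assms by (intro integrable_mult_AE_bounded) (auto simp: Linf_def)
qed

lemma Linf_diff:
  assumes h: "h \<in> Linf M" and k: "k \<in> Linf M"
  shows "(\<lambda>x. h x - k x) \<in> Linf M"
proof -
  obtain C where C: "AE x in M. \<bar>h x\<bar> \<le> C" using Linf_AE_boundE[OF h] by blast
  obtain D where "AE x in M. \<bar>k x\<bar> \<le> D" using Linf_AE_boundE[OF k] by blast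
  with C have "AE x in M. \<bar>h x - k x\<bar> \<le> C + D" by eventually_elim auto
  then show ?thesis using h k by (intro LinfI) (auto simp: Linf_def)
qed

text \<open>Converse of the Hoelder estimate: test against the sign of \<open>k\<close> on the set
  \<open>B\<close> where the bound fails. There \<open>u x * k x - r * \<bar>u x\<bar>\<close>
  equals \<open>\<bar>k x\<bar> - r > 0\<close> and elsewhere it is 0, yet its integral is at most
  0, so \<open>B\<close> is null. Finiteness of the measure makes this test function
  integrable.\<close>

lemma AE_bound_if_integral_bound:
  fixes k :: "'a \<Rightarrow> real"
  assumes "finite_measure M" and k: "k \<in> Linf M"
    and le: "\<And>u. integrable M u \<Longrightarrow> \<bar>\<integral>x. u x * k x \<partial>M\<bar> \<le> r * L1_norm M u"
  shows "AE x in M. \<bar>k x\<bar> \<le> r"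
proof -
  interpret finite_measure M by fact
  have [measurable]: "k \<in> borel_measurable M" using k by (simp add: Linf_def)
  define B where "B = {x \<in> space M. \<bar>k x\<bar> > r}"
  have B[measurable]: "B \<in> sets M" unfolding B_def by measurable
  define u where "u x = indicat_real B x * (if k x \<ge> 0 then 1 else - 1)" for x
  have u: "integrable M u"
    unfolding u_def by (rule integrable_const_bound[of _ 1]) (auto simp: indicator_def abs_sgn_eq)
  have iu: "integrable M (\<lambda>x. u x * k x)" by (rule integrable_mult_Linf[OF u k])
  define w where "w x = u x * k x - r * \<bar>u x\<bar>" for x
  have iw: "integrable M w" unfolding w_def using u iu by auto
  have w0: "w x \<ge> 0" for x
    by (auto simp: w_def u_def B_def indicator_def)
  have "integral\<^sup>L M w = (\<integral>x. u x * k x \<partial>M) - r * L1_norm M u"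
    unfolding w_def L1_norm_def using u iu by simp
  then have "integral\<^sup>L M w \<le> 0" using le[OF u] by linarith
  then have "integral\<^sup>L M w = 0" using w0 by (intro order.antisym integral_nonneg_AE) auto
  then have "AE x in M. w x = 0" using integral_nonneg_eq_0_iff_AE[OF iw] w0 by simp
  with AE_space show ?thesis
  proof eventually_elim
    case (elim x)
    show ?case
    proof (rule ccontr)
      assume c: "\<not> \<bar>k x\<bar> \<le> r"
      then have "x \<in> B" using elim by (simp add: B_def)
      with elim(2) have "\<bar>k x\<bar> = r"
        by (auto simp: w_def u_def split: if_splits)
      with c show False by simp
    qed
  qed
qed

section \<open>Operator norms and representatives of the adjoint\<close>

lemma L1_norm_nonneg: "0 \<le> L1_norm M f"
  by (simp add: L1_norm_def)

lemma L1_norm_cmult: "L1_norm M (\<lambda>x. c * f x) = \<bar>c\<bar> * L1_norm M f"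
  by (simp add: L1_norm_def abs_mult)

lemma L1_opnorm_bound:
  assumes T: "L1_operator M T" and f: "integrable M f"
  shows "norm (T f) \<le> L1_opnorm M T * L1_norm M f"
proof -
  obtain C where C: "C \<ge> 0" "\<And>f. integrable M f \<Longrightarrow> norm (T f) \<le> C * L1_norm M f"
    using L1_operator_bound[OF T] by blast
  show ?thesis
  proof (cases "L1_norm M f = 0")
    case True
    then show ?thesis using C(2)[OF f] by simp
  next
    case False
    define n where "n = L1_norm M f"
    have n: "n > 0" using False L1_norm_nonneg[of M f] by (simp add: n_def)
    \<comment> \<open>A supremum of reals bounds the members of the set only once the set is known
      to be bounded above.\<close>
    have bdd: "bdd_above ((\<lambda>f. norm (T f)) ` {f. integrable M f \<and> L1_norm M f \<le> 1})"
    proof (rule bdd_aboveI2)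
      fix g assume "g \<in> {f. integrable M f \<and> L1_norm M f \<le> 1}"
      then have "norm (T g) \<le> C * L1_norm M g" "C * L1_norm M g \<le> C * 1"
        using C by (auto intro!: mult_left_mono simp del: mult_1_right)
      then show "norm (T g) \<le> C * 1" by (rule order_trans)
    qed
    have "norm (T (\<lambda>x. (1/n) * f x)) \<le> L1_opnorm M T"
      unfolding L1_opnorm_def
    proof (rule cSUP_upper[OF _ bdd])
      show "(\<lambda>x. (1/n) * f x) \<in> {f. integrable M f \<and> L1_norm M f \<le> 1}"
        using f n L1_norm_cmult[of M "1/n" f] by (simp add: n_def)
    qed
    moreover have "T (\<lambda>x. (1/n) * f x) = (1/n) *\<^sub>R T f"
      using T f unfolding L1_operator_def by blast
    ultimately show ?thesis using n by (simp add: n_def[symmetric] field_simps)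
  qed
qed

lemma L1_opnorm_le:
  assumes "C \<ge> 0" "\<And>f. integrable M f \<Longrightarrow> norm (T f) \<le> C * L1_norm M f"
  shows "L1_opnorm M T \<le> C"
  unfolding L1_opnorm_def
proof (rule cSUP_least)
  show "{f. integrable M f \<and> L1_norm M f \<le> 1} \<noteq> {}"
    by (auto intro!: exI[of _ "\<lambda>_. 0"] simp: L1_norm_def)
next
  fix f assume "f \<in> {f. integrable M f \<and> L1_norm M f \<le> 1}"
  then have "norm (T f) \<le> C * L1_norm M f" "C * L1_norm M f \<le> C * 1"
    using assms by (auto intro: mult_left_mono simp del: mult_1_right)
  then show "norm (T f) \<le> C" by simp
qed

lemma adjoint_delta_measurable:
  assumes "finite_measure M" "L1_operator M T"
  shows "adjoint_delta M T s \<in> borel_measurable M"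
  using adjoint_delta(1)[OF assms] by (simp add: Linf_def)

text \<open>Evaluation at a point is a contraction on C(K), so the functional represented by
  \<open>adjoint_delta M T s\<close> is bounded by the norm of \<open>T\<close>; the converse of
  Hoelder turns this into a pointwise bound.\<close>

lemma adjoint_delta_AE_bound:
  fixes T :: "('a \<Rightarrow> real) \<Rightarrow> ('k::topological_space \<Rightarrow>\<^sub>C real)"
  assumes M: "finite_measure M" and T: "L1_operator M T"
  shows "AE x in M. \<bar>adjoint_delta M T s x\<bar> \<le> L1_opnorm M T"
proof (rule AE_bound_if_integral_bound[OF M adjoint_delta(1)[OF M T]])
  fix u :: "'a \<Rightarrow> real" assume u: "integrable M u"
  have "\<bar>apply_bcontfun (T u) s\<bar> \<le> norm (T u)"
    using norm_bounded[of "T u" s] by simp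
  also have "\<dots> \<le> L1_opnorm M T * L1_norm M u" by (rule L1_opnorm_bound[OF T u])
  finally show "\<bar>\<integral>x. u x * adjoint_delta M T s x \<partial>M\<bar> \<le> L1_opnorm M T * L1_norm M u"
    using adjoint_delta(2)[OF M T] u by simp
qed

text \<open>This lets an explicit formula replace the representative picked by \<open>SOME\<close>.
  The difference of two representatives annihilates every integrable function, so the converse of
  Hoelder applies with bound 0.\<close>

lemma adjoint_delta_unique:
  fixes T :: "('a \<Rightarrow> real) \<Rightarrow> ('k::topological_space \<Rightarrow>\<^sub>C real)"
  assumes M: "finite_measure M" and T: "L1_operator M T" and k: "k \<in> Linf M"
    and rep: "\<And>u. integrable M u \<Longrightarrow> apply_bcontfun (T u) s = (\<integral>x. u x * k x \<partial>M)"
  shows "AE x in M. adjoint_delta M T s x = k x"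
proof -
  let ?h = "adjoint_delta M T s"
  have h: "?h \<in> Linf M" by (rule adjoint_delta(1)[OF M T])
  have "AE x in M. \<bar>?h x - k x\<bar> \<le> 0"
  proof (rule AE_bound_if_integral_bound[OF M Linf_diff[OF h k]])
    fix u :: "'a \<Rightarrow> real" assume u: "integrable M u"
    then show "\<bar>\<integral>x. u x * (?h x - k x) \<partial>M\<bar> \<le> 0 * L1_norm M u"
      using rep[OF u] adjoint_delta(2)[OF M T, rule_format, OF u]
        integrable_mult_Linf[OF u h] integrable_mult_Linf[OF u k]
      by (simp add: right_diff_distrib)
  qed
  then show ?thesis by eventually_elim auto
qed

text \<open>By duality, membership means one inequality for each integrable \<open>u\<close>. In it,
  \<open>s\<close> enters only through the continuous function \<open>T u\<close>, so the set is an
  intersection of closed sets.\<close>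

lemma closed_adjoint_delta_ball:
  fixes T :: "('a \<Rightarrow> real) \<Rightarrow> ('k::topological_space \<Rightarrow>\<^sub>C real)"
  assumes M: "finite_measure M" and T: "L1_operator M T" and d: "d \<in> Linf M"
  shows "closed {s. AE x in M. \<bar>adjoint_delta M T s x - d x\<bar> \<le> r}"
proof -
  let ?h = "adjoint_delta M T"
  have h: "?h s \<in> Linf M" for s by (rule adjoint_delta(1)[OF M T])
  note hd = Linf_diff[OF h d]
  have eq: "(\<integral>x. u x * (?h s x - d x) \<partial>M) = apply_bcontfun (T u) s - (\<integral>x. u x * d x \<partial>M)"
    if u: "integrable M u" for s u
    using adjoint_delta(2)[OF M T, rule_format, OF u]
        integrable_mult_Linf[OF u h] integrable_mult_Linf[OF u d]
      by (simp add: right_diff_distrib)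
  have iff: "(AE x in M. \<bar>?h s x - d x\<bar> \<le> r) \<longleftrightarrow>
    (\<forall>u. integrable M u \<longrightarrow> \<bar>apply_bcontfun (T u) s - (\<integral>x. u x * d x \<partial>M)\<bar> \<le> r * L1_norm M u)" for s
  proof
    assume ae: "AE x in M. \<bar>?h s x - d x\<bar> \<le> r"
    have meas: "(\<lambda>x. ?h s x - d x) \<in> borel_measurable M"
      using hd by (simp add: Linf_def)
    show "\<forall>u. integrable M u \<longrightarrow> \<bar>apply_bcontfun (T u) s - (\<integral>x. u x * d x \<partial>M)\<bar> \<le> r * L1_norm M u"
      using integral_mult_AE_bounded[OF _ meas ae] eq by simp
  next
    assume "\<forall>u. integrable M u \<longrightarrow> \<bar>apply_bcontfun (T u) s - (\<integral>x. u x * d x \<partial>M)\<bar> \<le> r * L1_norm M u"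
    then show "AE x in M. \<bar>?h s x - d x\<bar> \<le> r"
      by (intro AE_bound_if_integral_bound[OF M hd]) (simp add: eq)
  qed
  have "{s. AE x in M. \<bar>?h s x - d x\<bar> \<le> r} =
    (\<Inter>u\<in>{u. integrable M u}. {s. \<bar>apply_bcontfun (T u) s - (\<integral>x. u x * d x \<partial>M)\<bar> \<le> r * L1_norm M u})"
    unfolding iff by auto
  also have "closed \<dots>"
    by (intro closed_INT ballI closed_Collect_le continuous_intros) auto
  finally show ?thesis .
qed

section \<open>Urysohn functions and Baire category in compact Hausdorff spaces\<close>

lemma compact_t2_normal_space:
  assumes "compact (UNIV :: 'k::t2_space set)"
  shows "normal_space (euclidean :: 'k topology)"
proof (rule compact_Hausdorff_or_regular_imp_normal_space)
  show "compact_space (euclidean :: 'k topology)"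
    using assms by (simp add: compact_space_def)
  show "Hausdorff_space (euclidean :: 'k topology) \<or> regular_space (euclidean :: 'k topology)"
    unfolding Hausdorff_space_def disjnt_def by (simp add: separation_t2) 
qed

lemma compact_t2_Urysohn:
  fixes a :: "'k::t2_space"
  assumes K: "compact (UNIV :: 'k set)" and V: "open V" "a \<in> V"
  obtains \<phi> :: "'k \<Rightarrow> real" where "continuous_on UNIV \<phi>" "\<And>s. 0 \<le> \<phi> s" "\<And>s. \<phi> s \<le> 1"
    "\<phi> a = 1" "\<And>s. s \<notin> V \<Longrightarrow> \<phi> s = 0"
proof -
  have "closedin euclidean (- V)" "closedin euclidean {a}" "disjnt (- V) {a}"
    using V by (auto simp: disjnt_def closed_closedin[symmetric])
  then obtain \<phi> :: "'k \<Rightarrow> real" where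
    \<phi>: "continuous_map euclidean (top_of_set {0..1}) \<phi>" "\<phi> ` (- V) \<subseteq> {0}" "\<phi> ` {a} \<subseteq> {1}"
    using Urysohn_lemma[OF compact_t2_normal_space[OF K], of "- V" "{a}" 0 1] by auto
  show ?thesis
  proof (rule that[of \<phi>])
    show "continuous_on UNIV \<phi>" "0 \<le> \<phi> s" "\<phi> s \<le> 1" for s
      using \<phi>(1) by (auto simp: continuous_map_in_subtopology)
  qed (use \<phi> in auto)
qed

lemma compact_t2_Baire:
  fixes \<G> :: "'k::t2_space set set"
  assumes K: "compact (UNIV :: 'k set)" and "countable \<G>"
    and "\<And>A. A \<in> \<G> \<Longrightarrow> closed A \<and> interior A = {}"
  shows "interior (\<Union>\<G>) = {}"
proof -
  have cs: "compact_space (euclidean :: 'k topology)"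
    using K by (simp add: compact_space_def)
  have "locally_compact_space (euclidean :: 'k topology)"
    using cs by (simp add: compact_imp_locally_compact_space)
  moreover have "regular_space (euclidean :: 'k topology)"
    using compact_t2_normal_space[OF K] by (intro normal_t1_imp_regular_space) (auto simp: t1_space_closedin_singleton)
  ultimately show ?thesis
    using Baire_category_alt[of "euclidean :: 'k topology" \<G>] assms by simp
qed

text \<open>Otherwise \<open>U\<close> would be covered by the closures of the nowhere dense sets
  making up the complement of \<open>G\<close>, together with the sets
  \<open>F d - interior (F d)\<close>. These are countably many closed sets with empty interior,
  contrary to Baire's theorem.\<close>

lemma comeager_countable_closed_cover:
  fixes U :: "'k::t2_space set"
  assumes K: "compact (UNIV :: 'k set)" and G: "comeager G"
    and D: "countable D" "\<And>d. d \<in> D \<Longrightarrow> closed (F d)" "G \<subseteq> (\<Union>d\<in>D. F d)"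
    and U: "open U" "U \<noteq> {}"
  obtains d where "d \<in> D" "U \<inter> interior (F d) \<noteq> {}"
proof -
  obtain N :: "nat \<Rightarrow> 'k set" where N: "\<And>n. interior (closure (N n)) = {}" "- G = (\<Union>n. N n)"
    using G by (auto simp: comeager_def meager_def nowhere_dense_def)
  have "\<exists>d\<in>D. U \<inter> interior (F d) \<noteq> {}"
  proof (rule ccontr)
    assume "\<not> ?thesis"
    then have disj: "U \<inter> interior (F d) = {}" if "d \<in> D" for d using that by blast
    let ?\<G> = "range (\<lambda>n. closure (N n)) \<union> (\<lambda>d. F d - interior (F d)) ` D"
    have "interior (\<Union>?\<G>) = {}"
    proof (rule compact_t2_Baire[OF K])
      fix A assume "A \<in> ?\<G>"
      moreover have "interior (F d - interior (F d)) = {}" for d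
        using interior_maximal[OF _ open_interior, of "F d - interior (F d)" "F d"]
          interior_subset[of "F d - interior (F d)"] interior_mono[of "F d - interior (F d)" "F d"] by blast
      ultimately show "closed A \<and> interior A = {}"
        using N(1) D(2) by (auto intro: closed_Diff)
    qed (use D in auto)
    moreover have "U \<subseteq> \<Union>?\<G>"
    proof
      fix s assume s: "s \<in> U"
      show "s \<in> \<Union>?\<G>"
      proof (cases "s \<in> G")
        case True
        then obtain d where "d \<in> D" "s \<in> F d" using D(3) by blast
        with disj s show ?thesis by blast
      next
        case False
        then have "s \<in> (\<Union>n. N n)" using N(2) by blast
        then show ?thesis using closure_subset by blast
      qed
    qed
    ultimately show False using U interior_maximal[of U "\<Union>?\<G>"] by blast
  qed
  then show ?thesis using that by blast
qed

section \<open>A criterion for separability in the essential supremum norm\<close>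

text \<open>\<open>Linf_separable\<close> asks for a dense sequence inside \<open>A\<close>, while
  natural approximants often lie outside. For each approximant \<open>c\<close> and each
  \<open>n\<close>, one member of \<open>A\<close> within 1/(n+1) of \<open>c\<close> is selected
  whenever there is one.\<close>

lemma Linf_separableI:
  assumes A: "A \<subseteq> borel_measurable M" and C: "countable C"
    and approx: "\<And>h e. h \<in> A \<Longrightarrow> e > 0 \<Longrightarrow> \<exists>c\<in>C. AE x in M. \<bar>h x - c x\<bar> \<le> e"
  shows "Linf_separable M A"
proof -
  let ?P = "\<lambda>c n h. h \<in> A \<and> (AE x in M. \<bar>h x - c x\<bar> \<le> inverse (real (Suc n)))"
  define D where "D = {h. \<exists>c\<in>C. \<exists>n. (\<exists>h. ?P c n h) \<and> h = (SOME h. ?P c n h)}"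
  have "D \<subseteq> (\<lambda>(c, n). SOME h. ?P c n h) ` (C \<times> UNIV)" unfolding D_def by auto
  then have "countable D" by (rule countable_subset) (use C in auto)
  moreover have "D \<subseteq> A"
  proof
    fix h assume "h \<in> D"
    then obtain c n where "\<exists>h. ?P c n h" "h = (SOME h. ?P c n h)" unfolding D_def by auto
    then show "h \<in> A" using someI_ex[of "?P c n"] by simp
  qed
  moreover have "\<exists>d\<in>D. Linf_norm M (\<lambda>x. h x - d x) < ereal e" if h: "h \<in> A" and e: "e > 0" for h and e :: real
  proof -
    \<comment> \<open>The passage from \<open>h\<close> through \<open>c\<close> to the selected
      member of \<open>A\<close> costs the radius twice.\<close>
    obtain n where n: "inverse (real (Suc n)) < e / 2"
      using reals_Archimedean[of "e/2"] e by auto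
    obtain c where c: "c \<in> C" "AE x in M. \<bar>h x - c x\<bar> \<le> inverse (real (Suc n))"
      using approx[OF h, of "inverse (real (Suc n))"] by auto
    define d where "d = (SOME h. ?P c n h)"
    have "\<exists>h. ?P c n h" using h c by blast
    then have d: "?P c n d" unfolding d_def by (rule someI_ex)
    have dD: "d \<in> D" unfolding D_def using \<open>\<exists>h. ?P c n h\<close> c(1) d_def by blast
    have "AE x in M. \<bar>h x - d x\<bar> \<le> 2 * inverse (real (Suc n))"
      using c(2) conjunct2[OF d] by eventually_elim linarith
    then have "Linf_norm M (\<lambda>x. h x - d x) \<le> ereal (2 * inverse (real (Suc n)))"
      using h d A by (intro Linf_norm_le) (auto intro!: borel_measurable_diff)
    also have "\<dots> < ereal e" using n by simp
    finally show ?thesis using dD by blast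
  qed
  ultimately show ?thesis unfolding Linf_separable_def by blast
qed

section \<open>The perturbed operator and its adjoint\<close>

text \<open>
  \<open>blend A p t h\<close> moves \<open>h\<close> towards \<open>p\<close> by the fraction \<open>t\<close>, on \<open>A\<close> only. The operator
  \<open>bump_operator M T \<phi> A p\<close> below is the one whose adjoint sends \<open>\<delta>\<^sub>s\<close> to
  \<open>blend A p (\<phi> s) (T\<^sup>* \<delta>\<^sub>s)\<close>; its defining formula makes the continuity in \<open>s\<close> evident.
\<close>

definition blend :: "'a set \<Rightarrow> ('a \<Rightarrow> real) \<Rightarrow> real \<Rightarrow> ('a \<Rightarrow> real) \<Rightarrow> 'a \<Rightarrow> real" where
  "blend A p t h x = h x + t * (indicator A x * (p x - h x))"

lemma blend_measurable [measurable]: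
  assumes [measurable]: "A \<in> sets M" "p \<in> borel_measurable M" "h \<in> borel_measurable M"
  shows "blend A p t h \<in> borel_measurable M"
  unfolding blend_def[abs_def] by measurable

lemma blend_bound:
  assumes "\<bar>h x\<bar> \<le> r" "\<bar>p x\<bar> \<le> r" "0 \<le> t" "t \<le> 1"
  shows "\<bar>blend A p t h x\<bar> \<le> r"
proof -
  have "\<bar>(1 - t) * h x + t * p x\<bar> \<le> (1 - t) * r + t * r"
  proof (rule order_trans[OF abs_triangle_ineq add_mono])
    show "\<bar>(1 - t) * h x\<bar> \<le> (1 - t) * r" "\<bar>t * p x\<bar> \<le> t * r"
      using assms by (auto simp: abs_mult intro: mult_left_mono)
  qed
  then show ?thesis
    using assms(1) by (auto simp: blend_def indicator_def algebra_simps)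
qed

text \<open>On \<open>A\<close> the difference is split as
  \<open>(1 - q) * (h x - d x) + (t - q) * (p x - h x)\<close>. Pairing \<open>t - q\<close> with
  \<open>p x - h x\<close> rather than \<open>p x - d x\<close> means that no bound on the
  approximant \<open>d\<close> is required.\<close>

lemma blend_diff_bound:
  assumes h: "\<bar>h x - d x\<bar> \<le> e" and p: "\<bar>p x\<bar> \<le> r" and hr: "\<bar>h x\<bar> \<le> r"
    and t: "0 \<le> t" "t \<le> 1" and q: "\<bar>t - q\<bar> \<le> e" "0 \<le> q" "q \<le> 1"
  shows "\<bar>blend A p t h x - blend A p q d x\<bar> \<le> e + e * (2 * r)"
proof (cases "x \<in> A")
  case True
  have "blend A p t h x - blend A p q d x = (1 - q) * (h x - d x) + (t - q) * (p x - h x)"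
    using True by (simp add: blend_def algebra_simps)
  also have "\<bar>\<dots>\<bar> \<le> e + e * (2 * r)"
  proof (rule order_trans[OF abs_triangle_ineq add_mono])
    have "\<bar>(1 - q) * (h x - d x)\<bar> \<le> 1 * e"
      unfolding abs_mult using h q by (intro mult_mono) auto
    then show "\<bar>(1 - q) * (h x - d x)\<bar> \<le> e" by simp
    show "\<bar>(t - q) * (p x - h x)\<bar> \<le> e * (2 * r)"
      unfolding abs_mult using p hr q by (intro mult_mono) auto
  qed
  finally show ?thesis .
next
  case False
  have "0 \<le> e * (2 * r)" using h p by (intro mult_nonneg_nonneg) auto
  with False h show ?thesis by (simp add: blend_def)
qed

definition bump_operator ::
  "'a measure \<Rightarrow> (('a \<Rightarrow> real) \<Rightarrow> ('k::topological_space \<Rightarrow>\<^sub>C real)) \<Rightarrow> ('k \<Rightarrow> real) \<Rightarrow> 'a set \<Rightarrow> ('a \<Rightarrow> real)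
    \<Rightarrow> ('a \<Rightarrow> real) \<Rightarrow> ('k \<Rightarrow>\<^sub>C real)" where
  "bump_operator M T \<phi> A p u = Bcontfun (\<lambda>s. apply_bcontfun (T u) s + \<phi> s *
     ((\<integral>x. u x * (indicator A x * p x) \<partial>M) - apply_bcontfun (T (\<lambda>x. u x * indicator A x)) s))"

context
  fixes M :: "'a measure" and T :: "('a \<Rightarrow> real) \<Rightarrow> ('k::t2_space \<Rightarrow>\<^sub>C real)"
    and \<phi> :: "'k \<Rightarrow> real" and A :: "'a set" and p :: "'a \<Rightarrow> real"
  assumes K: "compact (UNIV :: 'k set)" and M: "finite_measure M"
    and T: "L1_operator M T" and T1: "L1_opnorm M T \<le> 1"
    and \<phi>: "continuous_on UNIV \<phi>" "\<And>s. 0 \<le> \<phi> s" "\<And>s. \<phi> s \<le> 1"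
    and A[measurable]: "A \<in> sets M"
    and p[measurable]: "p \<in> borel_measurable M" and p1: "\<And>x. \<bar>p x\<bar> \<le> 1"
begin

lemma contraction_adjoint_measurable [measurable]: "adjoint_delta M T s \<in> borel_measurable M"
  by (rule adjoint_delta_measurable[OF M T])

lemma contraction_adjoint_bound: "AE x in M. \<bar>adjoint_delta M T s x\<bar> \<le> 1"
  using adjoint_delta_AE_bound[OF M T, of s] by eventually_elim (use T1 in auto)

lemma blend_adjoint_bound: "AE x in M. \<bar>blend A p (\<phi> s) (adjoint_delta M T s) x\<bar> \<le> 1"
  using contraction_adjoint_bound[of s] by eventually_elim (intro blend_bound \<phi> p1)

text \<open>The defining formula is continuous on a compact space, hence bounded, so
  \<open>Bcontfun\<close> returns a function with exactly these values. Writing \<open>T\<close> as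
  a pairing with its adjoint merges the three terms into one integral.\<close>

lemma bump_operator_apply:
  assumes u: "integrable M u"
  shows "apply_bcontfun (bump_operator M T \<phi> A p u) s =
    (\<integral>x. u x * blend A p (\<phi> s) (adjoint_delta M T s) x \<partial>M)"
proof -
  let ?F = "\<lambda>s. apply_bcontfun (T u) s + \<phi> s *
     ((\<integral>x. u x * (indicator A x * p x) \<partial>M) - apply_bcontfun (T (\<lambda>x. u x * indicator A x)) s)"
  let ?h = "adjoint_delta M T s"
  have cont: "continuous_on UNIV ?F" by (intro continuous_intros \<phi>) auto
  then have "bounded (range ?F)" using compact_continuous_image[OF _ K] compact_imp_bounded by blast
  with cont have "?F \<in> bcontfun" by (simp add: bcontfun_def)
  then have *: "apply_bcontfun (bump_operator M T \<phi> A p u) s = ?F s"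
    unfolding bump_operator_def by (simp add: Bcontfun_inverse)
  have uA: "integrable M (\<lambda>x. u x * indicator A x)"
    using integrable_mult_indicator[OF A u] by (simp add: mult.commute)
  note rep = adjoint_delta(2)[OF M T, rule_format, of _ s]
  have i: "integrable M (\<lambda>x. u x * ?h x)" "integrable M (\<lambda>x. u x * indicator A x * ?h x)"
    using integrable_mult_Linf[OF _ adjoint_delta(1)[OF M T]] u uA by auto
  have "integrable M (\<lambda>x. u x * (indicator A x * p x))"
    by (rule integrable_mult_AE_bounded[OF u, of _ 1]) (use p1 in \<open>auto simp: indicator_def\<close>)
  then have "(\<integral>x. u x * ?h x + \<phi> s * (u x * (indicator A x * p x) - u x * indicator A x * ?h x) \<partial>M) = ?F s"
    using i by (simp add: rep[OF u] rep[OF uA])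
  moreover have "(\<lambda>x. u x * ?h x + \<phi> s * (u x * (indicator A x * p x) - u x * indicator A x * ?h x))
      = (\<lambda>x. u x * blend A p (\<phi> s) ?h x)"
    by (auto simp: blend_def algebra_simps)
  ultimately show ?thesis using * by simp
qed

lemma bump_operator_norm_le:
  assumes u: "integrable M u"
  shows "norm (bump_operator M T \<phi> A p u) \<le> L1_norm M u"
proof (rule norm_bound)
  fix s
  show "norm (apply_bcontfun (bump_operator M T \<phi> A p u) s) \<le> L1_norm M u"
    using integral_mult_AE_bounded[OF u _ blend_adjoint_bound[of s]] by (simp add: bump_operator_apply[OF u])
qed

lemma L1_operator_bump_operator: "L1_operator M (bump_operator M T \<phi> A p)"
  unfolding L1_operator_def
proof (intro conjI allI impI exI[of _ 1])
  have i: "integrable M (\<lambda>x. u x * blend A p (\<phi> s) (adjoint_delta M T s) x)" if "integrable M u" for u s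
    by (rule integrable_mult_AE_bounded[OF that _ blend_adjoint_bound]) measurable
  fix u v :: "'a \<Rightarrow> real" and c :: real
  assume u: "integrable M u"
  show "bump_operator M T \<phi> A p (\<lambda>x. c * u x) = c *\<^sub>R bump_operator M T \<phi> A p u"
    by (rule bcontfun_eqI) (use u in \<open>simp add: bump_operator_apply mult.assoc\<close>)
  show "norm (bump_operator M T \<phi> A p u) \<le> 1 * L1_norm M u"
    using bump_operator_norm_le[OF u] by simp
  assume v: "integrable M v"
  show "bump_operator M T \<phi> A p (\<lambda>x. u x + v x) = bump_operator M T \<phi> A p u + bump_operator M T \<phi> A p v"
    by (rule bcontfun_eqI) (use u v i in \<open>simp add: bump_operator_apply distrib_right\<close>)
qed

lemma adjoint_delta_bump_operator:
  "AE x in M. adjoint_delta M (bump_operator M T \<phi> A p) s x = blend A p (\<phi> s) (adjoint_delta M T s) x"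
  by (rule adjoint_delta_unique[OF M L1_operator_bump_operator LinfI[OF _ blend_adjoint_bound] bump_operator_apply])
    measurable

text \<open>At \<open>s\<close> the adjoint of the difference is represented by \<phi>(s) times
  \<open>p - adjoint_delta M T s\<close> cut off to \<open>A\<close>. It vanishes for
  \<open>s\<close> outside \<open>V\<close>, and on \<open>V\<close> the factor \<phi>(s) \<le> 1
  keeps it below \<open>c\<close>.\<close>

lemma L1_opnorm_bump_operator_diff_le:
  assumes "c \<ge> 0" and V: "\<And>s. s \<notin> V \<Longrightarrow> \<phi> s = 0"
    and c: "\<And>s. s \<in> V \<Longrightarrow> AE x in M. x \<in> A \<longrightarrow> \<bar>p x - adjoint_delta M T s x\<bar> \<le> c"
  shows "L1_opnorm M (\<lambda>u. bump_operator M T \<phi> A p u - T u) \<le> c"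
proof (rule L1_opnorm_le[OF \<open>c \<ge> 0\<close>])
  fix u :: "'a \<Rightarrow> real" assume u: "integrable M u"
  show "norm (bump_operator M T \<phi> A p u - T u) \<le> c * L1_norm M u"
  proof (rule norm_bound)
    fix s
    let ?h = "adjoint_delta M T s"
    let ?k = "\<lambda>x. blend A p (\<phi> s) ?h x - ?h x"
    have k: "AE x in M. \<bar>?k x\<bar> \<le> c"
    proof (cases "s \<in> V")
      case True
      have *: "\<phi> s * b \<le> c" if "b \<le> c" "b \<ge> 0" for b
        using mult_left_le_one_le[OF \<open>b \<ge> 0\<close> \<phi>(2,3)[of s]] that by linarith
      show ?thesis
        using c[OF True]
        by eventually_elim (use * \<open>c \<ge> 0\<close> \<phi>(2)[of s] in \<open>auto simp: blend_def indicator_def abs_mult\<close>)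
    next
      case False
      then show ?thesis using V \<open>c \<ge> 0\<close> by (simp add: blend_def)
    qed
    have "integrable M (\<lambda>x. u x * blend A p (\<phi> s) ?h x)"
      by (rule integrable_mult_AE_bounded[OF u _ blend_adjoint_bound]) measurable
    then have "apply_bcontfun (bump_operator M T \<phi> A p u - T u) s = (\<integral>x. u x * ?k x \<partial>M)"
      using adjoint_delta(2)[OF M T, rule_format, OF u, of s]
        integrable_mult_Linf[OF u adjoint_delta(1)[OF M T]]
      by (simp add: bump_operator_apply[OF u] right_diff_distrib)
    then show "norm (apply_bcontfun (bump_operator M T \<phi> A p u - T u) s) \<le> c * L1_norm M u"
      using integral_mult_AE_bounded[OF u _ k] by simp
  qed
qed

text \<open>Blends of a countable dense family with rational fractions approximate all new adjoints,
  and the same \<open>G\<close> serves again. Such blends need not be adjoints themselves, which is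
  why \<open>Linf_separableI\<close> is used.\<close>

lemma Linf_separable_bump_operator:
  assumes "Linf_separable M (adjoint_delta M T ` G)"
  shows "Linf_separable M (adjoint_delta M (bump_operator M T \<phi> A p) ` G)"
proof -
  let ?h = "adjoint_delta M T"
  obtain D where D: "countable D"
    "\<forall>h\<in>?h ` G. \<forall>e>0. \<exists>d\<in>D. Linf_norm M (\<lambda>x. h x - d x) < ereal e"
    using assms unfolding Linf_separable_def by blast
  show ?thesis
  proof (rule Linf_separableI)
    show "countable ((\<lambda>(d, q). blend A p q d) ` (D \<times> \<rat>))"
      using D(1) countable_rat by auto
    show "adjoint_delta M (bump_operator M T \<phi> A p) ` G \<subseteq> borel_measurable M"
      using adjoint_delta_measurable[OF M L1_operator_bump_operator] by blast
  next
    fix k and e :: real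
    assume "k \<in> adjoint_delta M (bump_operator M T \<phi> A p) ` G" and e: "e > 0"
    then obtain s where s: "s \<in> G" "k = adjoint_delta M (bump_operator M T \<phi> A p) s" by blast
    \<comment> \<open>With \<open>r = 1\<close>, the bound in \<open>blend_diff_bound\<close> is
      three times the common error of \<open>d\<close> and \<open>q\<close>.\<close>
    have e3: "e / 3 > 0" using e by simp
    obtain d where d: "d \<in> D" "Linf_norm M (\<lambda>x. ?h s x - d x) < ereal (e / 3)"
      using D(2) s(1) e3 by blast
    \<comment> \<open>The fraction must stay in [0,1]. A rational just above \<phi>(s) works unless
      \<phi>(s) = 1, when 1 itself is taken.\<close>
    obtain q where q: "q \<in> \<rat>" "\<bar>\<phi> s - q\<bar> \<le> e / 3" "0 \<le> q" "q \<le> 1"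
    proof (cases "\<phi> s = 1")
      case True
      then show ?thesis using that[of 1] e by simp
    next
      case False
      then have "\<phi> s < min 1 (\<phi> s + e / 3)" using \<phi>(3)[of s] e by auto
      then obtain q where "q \<in> \<rat>" "\<phi> s < q" "q < min 1 (\<phi> s + e / 3)"
        using Rats_dense_in_real by blast
      then show ?thesis using that[of q] \<phi>(2)[of s] by auto
    qed
    have "AE x in M. \<bar>k x - blend A p q d x\<bar> \<le> e"
      using adjoint_delta_bump_operator[of s] contraction_adjoint_bound[of s] Linf_norm_less_AE[OF d(2)]
    proof eventually_elim
      case (elim x)
      have "\<bar>blend A p (\<phi> s) (?h s) x - blend A p q d x\<bar> \<le> e / 3 + e / 3 * (2 * 1)"
        by (rule blend_diff_bound) (use elim p1 \<phi> q in auto)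
      then show ?case using elim(1) s(2) by simp
    qed
    then show "\<exists>c\<in>(\<lambda>(d, q). blend A p q d) ` (D \<times> \<rat>). AE x in M. \<bar>k x - c x\<bar> \<le> e"
      using d(1) q(1) by (intro bexI[of _ "blend A p q d"]) auto
  qed
qed

end

section \<open>Restricting an almost norming function to the set where the functional is nearly
  extremal\<close>

text \<open>A Markov inequality: the function \<open>\<bar>f x\<bar> * (1 - h x * p x)\<close> is
  nonnegative almost everywhere with integral below \<open>\<epsilon>\<^sup>2 / 4\<close>, and off
  \<open>A\<close> its second factor is at least \<epsilon>/2.\<close>

lemma L1_functional_almost_norming:
  fixes f h :: "'a \<Rightarrow> real"
  assumes f: "integrable M f" "L1_norm M f = 1" and h: "h \<in> borel_measurable M" "AE x in M. \<bar>h x\<bar> \<le> 1"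
    and \<sigma>: "\<bar>\<sigma>\<bar> = 1" and \<epsilon>: "0 < \<epsilon>" "\<epsilon> < 1"
    and big: "\<sigma> * (\<integral>x. f x * h x \<partial>M) > 1 - \<epsilon>\<^sup>2 / 4"
    and p_def: "p = (\<lambda>x. \<sigma> * sgn (f x))"
    and A_def: "A = {x \<in> space M. h x * p x > 1 - \<epsilon> / 2}"
  shows "(\<integral>x. \<bar>f x\<bar> * indicator (- A) x \<partial>M) < \<epsilon> / 2"
    and "AE x in M. x \<in> A \<longrightarrow> \<bar>p x - h x\<bar> \<le> \<epsilon> / 2"
proof -
  have [measurable]: "f \<in> borel_measurable M" "h \<in> borel_measurable M" using f h by auto
  have p[measurable]: "p \<in> borel_measurable M" unfolding p_def by measurable
  have A[measurable]: "A \<in> sets M" unfolding A_def by measurable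
  have fp: "\<bar>f x\<bar> * p x = \<sigma> * f x" for x
    by (simp add: p_def abs_mult_sgn mult.left_commute)
  have p1: "\<bar>p x\<bar> \<le> 1" for x using \<sigma> by (simp add: p_def abs_mult abs_sgn_eq)
  have ifh: "integrable M (\<lambda>x. f x * h x)" by (rule integrable_mult_AE_bounded[OF f(1) h])
  have "integrable M (\<lambda>x. \<bar>f x\<bar> * indicator (space M - A) x)"
    using f by (intro integrable_real_mult_indicator) auto
  then have iA: "integrable M (\<lambda>x. \<bar>f x\<bar> * indicator (- A) x)"
    by (rule Bochner_Integration.integrable_cong[THEN iffD1, OF refl, rotated]) (auto simp: indicator_def)
  have "(\<integral>x. \<epsilon> / 2 * (\<bar>f x\<bar> * indicator (- A) x) \<partial>M) \<le> (\<integral>x. \<bar>f x\<bar> - \<sigma> * (f x * h x) \<partial>M)"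
  proof (rule integral_mono_AE)
    show "AE x in M. \<epsilon> / 2 * (\<bar>f x\<bar> * indicator (- A) x) \<le> \<bar>f x\<bar> - \<sigma> * (f x * h x)"
      using h(2) AE_space
    proof eventually_elim
      case (elim x)
      have eq: "\<bar>f x\<bar> - \<sigma> * (f x * h x) = \<bar>f x\<bar> * (1 - h x * p x)"
        using fp[of x] by (simp add: algebra_simps)
      have "\<bar>h x * p x\<bar> \<le> 1 * 1" unfolding abs_mult using elim(1) p1[of x] by (intro mult_mono) auto
      then have "\<epsilon> / 2 * indicator (- A) x \<le> 1 - h x * p x"
        using elim(2) by (auto simp: A_def indicator_def)
      then have "\<bar>f x\<bar> * (\<epsilon> / 2 * indicator (- A) x) \<le> \<bar>f x\<bar> * (1 - h x * p x)"
        by (rule mult_left_mono) simp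
      then show ?case unfolding eq by (simp add: ac_simps)
    qed
  qed (use f ifh iA in auto)
  also have "\<dots> = 1 - \<sigma> * (\<integral>x. f x * h x \<partial>M)"
    using f ifh by (simp add: L1_norm_def)
  also have "\<dots> < \<epsilon>\<^sup>2 / 4" using big by simp
  finally have "\<epsilon> / 2 * (\<integral>x. \<bar>f x\<bar> * indicator (- A) x \<partial>M) < \<epsilon> / 2 * (\<epsilon> / 2)"
    by (simp add: power2_eq_square)
  then show "(\<integral>x. \<bar>f x\<bar> * indicator (- A) x \<partial>M) < \<epsilon> / 2"
    using \<epsilon> by (simp add: mult_less_cancel_left)
  show "AE x in M. x \<in> A \<longrightarrow> \<bar>p x - h x\<bar> \<le> \<epsilon> / 2"
    using h(2)
  proof eventually_elim
    case (elim x)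
    show ?case
    proof
      assume "x \<in> A"
      then have a: "h x * p x > 1 - \<epsilon> / 2" by (simp add: A_def)
      \<comment> \<open>The threshold 1 - \<epsilon>/2 is positive, so \<open>f x\<close> is nonzero
        on \<open>A\<close> and \<open>p x\<close> is a sign; then
        \<open>\<bar>p x - h x\<bar> = 1 - h x * p x\<close>.\<close>
      then have "p x \<noteq> 0" using \<epsilon> by auto
      then have "p x = 1 \<or> p x = - 1"
        using \<sigma> by (auto simp: p_def sgn_if abs_if split: if_splits)
      then show "\<bar>p x - h x\<bar> \<le> \<epsilon> / 2" using a elim by auto
    qed
  qed
qed

text \<open>Let \<open>a\<close> and \<open>b\<close> be the masses of |f| on and off
  \<open>A\<close>. Scaling by 1/a moves the part on \<open>A\<close> by (1/a - 1) a = b, and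
  dropping the rest costs another \<open>b\<close>, so the distance is 2b < \<epsilon>.\<close>

lemma L1_normalized_restriction:
  fixes f :: "'a \<Rightarrow> real"
  assumes f: "integrable M f" "L1_norm M f = 1" and A: "A \<in> sets M"
    and small: "(\<integral>x. \<bar>f x\<bar> * indicator (- A) x \<partial>M) < \<epsilon> / 2" and \<epsilon>: "\<epsilon> < 1"
  obtains c where "c > 0" "integrable M (\<lambda>x. c * (f x * indicator A x))"
    "L1_norm M (\<lambda>x. c * (f x * indicator A x)) = 1"
    "L1_norm M (\<lambda>x. f x - c * (f x * indicator A x)) < \<epsilon>"
proof -
  define a where "a = (\<integral>x. \<bar>f x\<bar> * indicator A x \<partial>M)"
  define b where "b = (\<integral>x. \<bar>f x\<bar> * indicator (- A) x \<partial>M)"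
  have iA: "integrable M (\<lambda>x. \<bar>f x\<bar> * indicator A x)" "integrable M (\<lambda>x. f x * indicator A x)"
    using f A by (auto intro!: integrable_real_mult_indicator)
  have eqB: "(\<lambda>x. \<bar>f x\<bar> * indicator (- A) x) = (\<lambda>x. \<bar>f x\<bar> - \<bar>f x\<bar> * indicator A x)"
    by (auto simp: indicator_def)
  have iB: "integrable M (\<lambda>x. \<bar>f x\<bar> * indicator (- A) x)"
    unfolding eqB using f iA by auto
  have ab: "a + b = 1"
    using f iA unfolding a_def b_def eqB by (simp add: L1_norm_def)
  have b: "0 \<le> b" "b < \<epsilon> / 2" using small by (auto simp: b_def)
  then have a: "0 < a" "a \<le> 1" using ab \<epsilon> by auto
  show ?thesis
  proof (rule that[of "1 / a"])
    show "L1_norm M (\<lambda>x. 1 / a * (f x * indicator A x)) = 1"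
      using a by (simp add: L1_norm_cmult) (simp add: L1_norm_def abs_mult a_def)
    have "L1_norm M (\<lambda>x. f x - 1 / a * (f x * indicator A x))
        = (\<integral>x. \<bar>f x\<bar> * indicator (- A) x + (1 / a - 1) * (\<bar>f x\<bar> * indicator A x) \<partial>M)"
      unfolding L1_norm_def
    proof (intro Bochner_Integration.integral_cong refl)
      fix x
      have "\<bar>f x - 1 / a * f x\<bar> = (1 / a - 1) * \<bar>f x\<bar>"
      proof -
        have "f x - 1 / a * f x = (1 - 1 / a) * f x" by (simp add: algebra_simps)
        moreover have "\<bar>1 - 1 / a\<bar> = 1 / a - 1" using a by (simp add: abs_if)
        ultimately show ?thesis by (simp add: abs_mult)
      qed
      then show "\<bar>f x - 1 / a * (f x * indicator A x)\<bar> =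
          \<bar>f x\<bar> * indicator (- A) x + (1 / a - 1) * (\<bar>f x\<bar> * indicator A x)"
        by (auto simp: indicator_def)
    qed
    also have "\<dots> = b + (1 / a - 1) * a"
      using iA iB by (simp add: a_def b_def)
    also have "(1 / a - 1) * a = b" using a ab by (simp add: left_diff_distrib)
    finally show "L1_norm M (\<lambda>x. f x - 1 / a * (f x * indicator A x)) < \<epsilon>" using b by linarith
  qed (use a iA in auto)
qed

section \<open>Choice of the point, the bump and the norm attaining pair\<close>

theorem theorem5p4:
  fixes M :: "'a measure"
    and T :: "('a \<Rightarrow> real) \<Rightarrow> ('k::t2_space \<Rightarrow>\<^sub>C real)"
    and f :: "'a \<Rightarrow> real"
    and \<epsilon> :: real
  assumes "finite_measure M"
    and "compact (UNIV :: 'k set)"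
    and "0 < \<epsilon>" and "\<epsilon> < 1"
    and "L1_operator M T" and "L1_opnorm M T = 1"
    and "\<exists>G. comeager G \<and> Linf_separable M (adjoint_delta M T ` G)"
    and "integrable M f" and "L1_norm M f = 1"
    and "norm (T f) > 1 - \<epsilon>\<^sup>2 / 4"
  shows "\<exists>(S :: ('a \<Rightarrow> real) \<Rightarrow> ('k \<Rightarrow>\<^sub>C real)) g.
           L1_operator M S \<and> L1_opnorm M S = 1 \<and>
           integrable M g \<and> L1_norm M g = 1 \<and>
           norm (S g) = 1 \<and>
           L1_opnorm M (\<lambda>h. S h - T h) < \<epsilon> \<and>
           L1_norm M (\<lambda>x. f x - g x) < \<epsilon> \<and>
           (\<exists>G'. comeager G' \<and> Linf_separable M (adjoint_delta M S ` G'))"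
proof -
  note M = assms(1) and K = assms(2) and T = assms(5) and f = assms(8,9)
  let ?h = "adjoint_delta M T"
  have h1: "AE x in M. \<bar>?h s x\<bar> \<le> 1" for s
    using adjoint_delta_AE_bound[OF M T] assms(6) by simp
  obtain G where G: "comeager G" "Linf_separable M (?h ` G)" using assms(7) by blast
  obtain D where D: "countable D" "D \<subseteq> ?h ` G"
    "\<forall>h\<in>?h ` G. \<forall>e>0. \<exists>d\<in>D. Linf_norm M (\<lambda>x. h x - d x) < ereal e"
    using G(2) unfolding Linf_separable_def by blast
  obtain s0 where s0: "\<bar>apply_bcontfun (T f) s0\<bar> > 1 - \<epsilon>\<^sup>2 / 4"
  proof -
    have "\<exists>s. \<not> norm (apply_bcontfun (T f) s) \<le> 1 - \<epsilon>\<^sup>2 / 4"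
      using assms(10) norm_bound[of "T f" "1 - \<epsilon>\<^sup>2 / 4"] by (meson not_le)
    then show ?thesis using that by (auto simp: not_le)
  qed
  \<comment> \<open>Fixing the sign at \<open>s0\<close> makes \<open>U\<close> a set on which the
    same \<sigma> works, so it can still be used at the point \<open>s1\<close> found later.\<close>
  define \<sigma> where "\<sigma> = (if apply_bcontfun (T f) s0 \<ge> 0 then 1 else - 1 :: real)"
  have \<sigma>: "\<bar>\<sigma>\<bar> = 1" by (simp add: \<sigma>_def)
  define U where "U = {s. \<sigma> * apply_bcontfun (T f) s > 1 - \<epsilon>\<^sup>2 / 4}"
  have "open U" unfolding U_def by (intro open_Collect_less continuous_intros) auto
  moreover have "s0 \<in> U" using s0 by (auto simp: U_def \<sigma>_def)
  \<comment> \<open>Adjoints at two points of the same \<open>F d\<close> differ by at most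
    \<epsilon>/4. Added to the error \<epsilon>/2 between \<open>p\<close> and the adjoint at
    \<open>s1\<close>, this gives 3\<epsilon>/4 and leaves room for the strict inequality.\<close>
  moreover define F where "F d = {s. AE x in M. \<bar>?h s x - d x\<bar> \<le> \<epsilon> / 8}" for d
  have "closed (F d)" if "d \<in> D" for d
    unfolding F_def using that D(2) adjoint_delta(1)[OF M T]
    by (intro closed_adjoint_delta_ball[OF M T]) blast
  moreover have "G \<subseteq> (\<Union>d\<in>D. F d)"
  proof
    fix s assume "s \<in> G"
    moreover have "\<epsilon> / 8 > 0" using assms(3) by simp
    ultimately obtain d where "d \<in> D" "Linf_norm M (\<lambda>x. ?h s x - d x) < ereal (\<epsilon> / 8)"
      using D(3) by blast
    then show "s \<in> (\<Union>d\<in>D. F d)" using Linf_norm_less_AE by (force simp: F_def)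
  qed
  ultimately obtain d where "U \<inter> interior (F d) \<noteq> {}"
    using comeager_countable_closed_cover[OF K G(1) D(1), of F U] by blast
  then obtain s1 where s1: "s1 \<in> U" "s1 \<in> interior (F d)" by blast
  obtain \<phi> :: "'k \<Rightarrow> real" where \<phi>: "continuous_on UNIV \<phi>" "\<And>s. 0 \<le> \<phi> s" "\<And>s. \<phi> s \<le> 1"
    "\<phi> s1 = 1" "\<And>s. s \<notin> interior (F d) \<Longrightarrow> \<phi> s = 0"
    using compact_t2_Urysohn[OF K open_interior s1(2)] by metis
  define p where "p = (\<lambda>x. \<sigma> * sgn (f x))"
  define A where "A = {x \<in> space M. ?h s1 x * p x > 1 - \<epsilon> / 2}"
  have h_meas [measurable]: "?h s1 \<in> borel_measurable M"
    by (rule adjoint_delta_measurable[OF M T])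
  have [measurable]: "f \<in> borel_measurable M" using f by auto
  have p: "p \<in> borel_measurable M" "\<And>x. \<bar>p x\<bar> \<le> 1"
    using \<sigma> by (auto simp: p_def abs_mult abs_sgn_eq)
  note [measurable] = p(1)
  have A: "A \<in> sets M" unfolding A_def by measurable
  have "\<sigma> * (\<integral>x. f x * ?h s1 x \<partial>M) > 1 - \<epsilon>\<^sup>2 / 4"
    using s1(1) adjoint_delta(2)[OF M T] f by (simp add: U_def)
  note norming = L1_functional_almost_norming[OF f h_meas h1 \<sigma> assms(3,4) this p_def A_def]
  obtain c where c: "c > 0" "integrable M (\<lambda>x. c * (f x * indicator A x))"
    "L1_norm M (\<lambda>x. c * (f x * indicator A x)) = 1"
    "L1_norm M (\<lambda>x. f x - c * (f x * indicator A x)) < \<epsilon>"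
    using L1_normalized_restriction[OF f A norming(1) assms(4)] by auto
  define g where "g = (\<lambda>x. c * (f x * indicator A x))"
  have g: "integrable M g" "L1_norm M g = 1" "L1_norm M (\<lambda>x. f x - g x) < \<epsilon>"
    unfolding g_def by (rule c)+
  define S where "S = bump_operator M T \<phi> A p"
  note bump = K M T order.eq_iff[THEN iffD1, OF assms(6), THEN conjunct1] \<phi>(1-3) A p
  have S: "L1_operator M S" unfolding S_def by (rule L1_operator_bump_operator[OF bump])
  have S_le: "norm (S u) \<le> L1_norm M u" if "integrable M u" for u
    unfolding S_def by (rule bump_operator_norm_le[OF bump that])
  \<comment> \<open>Since \<phi>(s1) = 1, the adjoint of \<open>S\<close> at \<open>s1\<close> is
    \<open>p\<close> on \<open>A\<close>, where \<open>g\<close> lives. As \<open>c > 0\<close>,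
    \<open>g\<close> has the sign of \<open>f\<close> there, hence
    \<open>g x * p x = \<sigma> * \<bar>g x\<bar>\<close>.\<close>
  have "apply_bcontfun (S g) s1 = (\<integral>x. \<sigma> * \<bar>g x\<bar> \<partial>M)"
    unfolding S_def bump_operator_apply[OF bump g(1)]
    using c(1) by (intro Bochner_Integration.integral_cong)
      (auto simp: g_def blend_def \<phi>(4) p_def indicator_def abs_mult abs_sgn sgn_mult mult_ac)
  also have "\<dots> = \<sigma>" using g(2) by (simp add: L1_norm_def)
  finally have Sg1: "norm (S g) \<ge> 1" using norm_bounded[of "S g" s1] \<sigma> by simp
  have Sg: "norm (S g) = 1" using Sg1 S_le[OF g(1)] g(2) by simp
  have "L1_opnorm M S = 1"
    using L1_opnorm_bound[OF S g(1)] Sg g(2) L1_opnorm_le[of 1 M S] S_le by simp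
  moreover have "L1_opnorm M (\<lambda>u. S u - T u) \<le> 3 / 4 * \<epsilon>"
    unfolding S_def
  proof (rule L1_opnorm_bump_operator_diff_le[OF bump _ \<phi>(5)])
    fix s assume "s \<in> interior (F d)"
    then have "AE x in M. \<bar>?h s x - d x\<bar> \<le> \<epsilon> / 8" "AE x in M. \<bar>?h s1 x - d x\<bar> \<le> \<epsilon> / 8"
      using s1(2) interior_subset[of "F d"] by (auto simp: F_def)
    with norming(2) show "AE x in M. x \<in> A \<longrightarrow> \<bar>p x - ?h s x\<bar> \<le> 3 / 4 * \<epsilon>"
    proof eventually_elim
      case (elim x)
      show ?case
      proof
        assume "x \<in> A"
        with elim have "\<bar>p x - ?h s1 x\<bar> \<le> \<epsilon> / 2" by blast
        moreover have "\<bar>p x - ?h s x\<bar> \<le> \<bar>p x - ?h s1 x\<bar> + \<bar>?h s1 x - d x\<bar> + \<bar>?h s x - d x\<bar>"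
          by arith
        ultimately show "\<bar>p x - ?h s x\<bar> \<le> 3 / 4 * \<epsilon>" using elim(2,3) by linarith
      qed
    qed
  qed (use assms(3) in auto)
  then have "L1_opnorm M (\<lambda>u. S u - T u) < \<epsilon>" using assms(3) by simp
  moreover have "Linf_separable M (adjoint_delta M S ` G)"
    unfolding S_def by (rule Linf_separable_bump_operator[OF bump G(2)])
  ultimately show ?thesis
    using S Sg g G(1) by (intro exI[of _ S] exI[of _ g] exI[of _ G] conjI)
qed

end
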